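(* Let $n\ge1$ and let $\xi$ be a Markov process, homogeneous in time and space, with state space $\mathbb R_+^n$, and let $(P_t)_{t>0}$ be the corresponding convolution semigroup of probability measures on $\mathbb R_+^n$. Put $g_1(s)=\int_{\mathbb R_+^n}e^{s\cdot u}\,dP_1(u)$ for $s\in(-\infty,0)^n$. Then the Laplace exponent $\psi$ of $\xi$, i.e. the function $\psi:(-\infty,0)^n\to\mathbb R$ determined by $g_1(s)=e^{\psi(s)}$, belongs to $\mathcal T_n$.
   Context: $\mathbb R_+=[0,\infty)$ and $a\cdot b=\sum_{i=1}^n a_ib_i$. A function in $C^\infty((-\infty,0)^n)$ is called absolutely monotone if it is nonnegative together with all its partial derivatives of all orders. $\mathcal T_n$ is the class of all nonpositive functions in $C^\infty((-\infty,0)^n)$ all of whose first-order partial derivatives are absolutely monotone. The transition probabilities of the time- and space-homogeneous process $\xi$ are given by probability measures $P_t$, $t>0$, on $\mathbb R_+^n$: $P_t$ is the distribution of the increment of $\xi$ over any time interval of length $t$, regardless of the starting time and position. By the Chapman–Kolmogorov equation these form a convolution semigroup: $P_{t+r}=P_t*P_r$ for all $t,r>0$. *)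

theory Defs
  imports "HOL-Probability.Probability"
begin

definition nonneg_orthant :: "(real ^ 'n) set"
  where "nonneg_orthant = {x. \<forall>i. 0 \<le> x $ i}"

definition neg_orthant :: "(real ^ 'n) set"
  where "neg_orthant = {x. \<forall>i. x $ i < 0}"

definition orthant_space :: "(real ^ 'n) measure"
  where "orthant_space = restrict_space borel nonneg_orthant"

definition partial_deriv :: "'n \<Rightarrow> (real ^ 'n \<Rightarrow> real) \<Rightarrow> real ^ 'n \<Rightarrow> real"
  where "partial_deriv i f x = deriv (\<lambda>h. f (x + h *\<^sub>R axis i 1)) 0"

primrec iter_partial :: "'n list \<Rightarrow> (real ^ 'n \<Rightarrow> real) \<Rightarrow> real ^ 'n \<Rightarrow> real"
  where
    "iter_partial [] f = f"
  | "iter_partial (i # is) f = partial_deriv i (iter_partial is f)"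

(* deriv is total, so existence of the partial derivatives is required separately.
   Only meant for open U: there, neither condition depends on f outside U. *)
definition C_infinity_on :: "(real ^ 'n) set \<Rightarrow> (real ^ 'n \<Rightarrow> real) \<Rightarrow> bool"
  where "C_infinity_on U f \<longleftrightarrow>
    (\<forall>is. continuous_on U (iter_partial is f) \<and>
      (\<forall>i. \<forall>x\<in>U. (\<lambda>h. iter_partial is f (x + h *\<^sub>R axis i 1)) field_differentiable (at 0)))"

definition absolutely_monotone :: "(real ^ 'n \<Rightarrow> real) \<Rightarrow> bool"
  where "absolutely_monotone f \<longleftrightarrow>
    C_infinity_on neg_orthant f \<and> (\<forall>is. \<forall>x\<in>neg_orthant. 0 \<le> iter_partial is f x)"

(* Functions on (-infinity, 0)^n are represented by total functions whose values
   elsewhere are irrelevant. *)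
definition T_class :: "(real ^ 'n \<Rightarrow> real) set"
  where "T_class = {f. C_infinity_on neg_orthant f \<and> (\<forall>x\<in>neg_orthant. f x \<le> 0) \<and>
    (\<forall>i. absolutely_monotone (partial_deriv i f))}"

(* A Markov process with time set [0, infinity), state space S and transition function K:
   K s t x is the law of the state at time t given the state x at time s. *)
locale markov_process = prob_space M
  for M :: "'a measure" +
  fixes S :: "'b measure"
    and \<xi> :: "real \<Rightarrow> 'a \<Rightarrow> 'b"
    and K :: "real \<Rightarrow> real \<Rightarrow> 'b \<Rightarrow> 'b measure"
  assumes process_measurable: "0 \<le> t \<Longrightarrow> \<xi> t \<in> measurable M S"
    and kernel: "0 \<le> s \<Longrightarrow> s < t \<Longrightarrow> K s t \<in> measurable S (prob_algebra S)"
    and Chapman_Kolmogorov: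
      "0 \<le> r \<Longrightarrow> r < s \<Longrightarrow> s < t \<Longrightarrow> x \<in> space S \<Longrightarrow>
        K r t x = Giry_Monad.bind (K r s x) (K s t)"
    and Markov_property:
      "0 \<le> s \<Longrightarrow> s < t \<Longrightarrow> B \<in> sets S \<Longrightarrow>
        AE \<omega> in M.
          real_cond_exp M
            (sigma (space M) {\<xi> u -` A \<inter> space M | u A. 0 \<le> u \<and> u \<le> s \<and> A \<in> sets S})
            (\<lambda>\<omega>. indicator B (\<xi> t \<omega>)) \<omega>
          = measure (K s t (\<xi> s \<omega>)) B"

locale homogeneous_markov_process = markov_process M orthant_space \<xi> K
  for M :: "'a measure"
    and \<xi> :: "real \<Rightarrow> 'a \<Rightarrow> real ^ 'n"
    and K :: "real \<Rightarrow> real \<Rightarrow> real ^ 'n \<Rightarrow> (real ^ 'n) measure" +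
  assumes time_homogeneous:
      "0 \<le> s \<Longrightarrow> s < t \<Longrightarrow> 0 \<le> h \<Longrightarrow> x \<in> nonneg_orthant \<Longrightarrow> K (s + h) (t + h) x = K s t x"
    and space_homogeneous:
      "0 \<le> s \<Longrightarrow> s < t \<Longrightarrow> x \<in> nonneg_orthant \<Longrightarrow> y \<in> nonneg_orthant \<Longrightarrow>
        K s t (x + y) = distr (K s t x) orthant_space (\<lambda>u. u + y)"

(* P t is the law of the increment over any time interval of length t, from any
   starting time s and position x. *)
definition increment_laws ::
    "(real \<Rightarrow> real \<Rightarrow> real ^ 'n \<Rightarrow> (real ^ 'n) measure) \<Rightarrow> (real \<Rightarrow> (real ^ 'n) measure) \<Rightarrow> bool"
  where "increment_laws K P \<longleftrightarrow>
    (\<forall>t>0. P t \<in> space (prob_algebra orthant_space) \<and>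
      (\<forall>s\<ge>0. \<forall>x\<in>nonneg_orthant. K s (s + t) x = distr (P t) orthant_space (\<lambda>u. x + u)))"

definition laplace_transform :: "(real ^ 'n) measure \<Rightarrow> real ^ 'n \<Rightarrow> real"
  where "laplace_transform Q s = (\<integral>u. exp (s \<bullet> u) \<partial>Q)"

definition is_laplace_exponent ::
    "(real \<Rightarrow> (real ^ 'n) measure) \<Rightarrow> (real ^ 'n \<Rightarrow> real) \<Rightarrow> bool"
  where "is_laplace_exponent P \<psi> \<longleftrightarrow>
    (\<forall>s\<in>neg_orthant. laplace_transform (P 1) s = exp (\<psi> s))"

end

theory Submission imports Defs begin

text \<open>
  The Laplace transform \<open>g\<^sub>t\<close> of \<open>P t\<close> is absolutely monotone, because each of its partial
  derivatives is the integral of a nonnegative monomial against \<open>exp (s \<bullet> u)\<close>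
  (\<open>absolutely_monotone_laplace\<close>), and it takes values in \<open>(0, 1]\<close>. So \<open>\<psi> = ln g\<^sub>1\<close> exists, is
  smooth and nonpositive; what is left is the sign of its derivatives.

  The Chapman-Kolmogorov equation makes \<open>t \<mapsto> g\<^sub>t\<close> multiplicative, hence
  \<open>g\<^sub>1\<^sub>/\<^sub>m = exp (\<psi> / m)\<close> (\<open>laplace_transform_root\<close>). Therefore \<open>m g\<^sub>1\<^sub>/\<^sub>m\<close>, whose derivatives of
  every order are nonnegative, has the first derivatives \<open>\<partial>\<^sub>i\<psi> g\<^sub>1\<^sub>/\<^sub>m\<close>. As \<open>m\<close> tends to infinity
  these converge to \<open>\<partial>\<^sub>i\<psi>\<close>, and so do all their higher derivatives, pointwise
  (\<open>iter_partial_mult_tendsto\<close>): every derivative that hits the factor \<open>g\<^sub>1\<^sub>/\<^sub>m\<close> brings out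
  a factor \<open>1/m\<close>. Nonnegativity passes to the limit. The product rule thus replaces an argument
  by locally uniform convergence of derivatives.
\<close>

section \<open>Calculus of iterated partial derivatives\<close>

definition partial_on where
  "partial_on U i f g \<longleftrightarrow>
    (\<forall>x\<in>U. ((\<lambda>h. f (x + h *\<^sub>R axis i 1)) has_field_derivative g x) (at 0))"
  for f g :: "real ^ 'n \<Rightarrow> real"

lemma partial_on_imp_eq: "partial_on U i f g \<Longrightarrow> x \<in> U \<Longrightarrow> partial_deriv i f x = g x"
  by (auto simp: partial_on_def partial_deriv_def intro: DERIV_imp_deriv)

lemma eventually_line_in_open:
  fixes U :: "(real ^ 'n) set"
  assumes "open U" "x \<in> U"
  shows "eventually (\<lambda>h. x + h *\<^sub>R axis i 1 \<in> U) (nhds (0::real))"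
proof -
  have "open ((\<lambda>h. x + h *\<^sub>R axis i 1) -` U)"
    by (intro open_vimage assms continuous_intros)
  then show ?thesis
    using assms(2) eventually_nhds_in_open[of "(\<lambda>h. x + h *\<^sub>R axis i 1) -` U" "0::real"] by simp
qed

lemma partial_on_cong:
  assumes "open U" "partial_on U i f g" "\<And>x. x \<in> U \<Longrightarrow> f x = f' x" "\<And>x. x \<in> U \<Longrightarrow> g x = g' x"
  shows "partial_on U i f' g'"
  unfolding partial_on_def
proof
  fix x assume x: "x \<in> U"
  have "eventually (\<lambda>h. f (x + h *\<^sub>R axis i 1) = f' (x + h *\<^sub>R axis i 1)) (nhds (0::real))"
    using eventually_line_in_open[OF assms(1) x] by eventually_elim (use assms(3) in auto)
  then show "((\<lambda>h. f' (x + h *\<^sub>R axis i 1)) has_field_derivative g' x) (at 0)"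
    using assms(2,4) x DERIV_cong_ev[OF refl, of _ _ 0 "g x" "g' x"]
    by (auto simp: partial_on_def)
qed

lemma partial_deriv_cong:
  assumes "open U" "\<And>y. y \<in> U \<Longrightarrow> f y = g y" "x \<in> U"
  shows "partial_deriv i f x = partial_deriv i g x"
  unfolding partial_deriv_def
  by (rule deriv_cong_ev[OF _ refl], use eventually_line_in_open[OF assms(1,3)] in eventually_elim)
     (use assms(2) in auto)

lemma iter_partial_cong:
  assumes "open U" "\<And>y. y \<in> U \<Longrightarrow> f y = g y" "x \<in> U"
  shows "iter_partial is f x = iter_partial is g x"
  using assms(3)
  by (induction "is" arbitrary: x) (auto simp: assms intro: partial_deriv_cong[OF assms(1)])

lemma iter_partial_append: "iter_partial (is @ js) f = iter_partial is (iter_partial js f)"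
  by (induction "is") auto

lemma partial_on_add:
  "partial_on U i a a' \<Longrightarrow> partial_on U i b b' \<Longrightarrow>
    partial_on U i (\<lambda>x. a x + b x) (\<lambda>x. a' x + b' x)"
  by (auto simp: partial_on_def intro!: DERIV_add)

lemma partial_on_mult:
  assumes "partial_on U i a a'" "partial_on U i b b'"
  shows "partial_on U i (\<lambda>x. a x * b x) (\<lambda>x. a' x * b x + b' x * a x)"
  unfolding partial_on_def
proof
  fix x assume "x \<in> U"
  then show "((\<lambda>h. a (x + h *\<^sub>R axis i 1) * b (x + h *\<^sub>R axis i 1)) has_field_derivative
      (a' x * b x + b' x * a x)) (at 0)"
    using DERIV_mult[of "\<lambda>h. a (x + h *\<^sub>R axis i 1)" "a' x" 0 UNIV
        "\<lambda>h. b (x + h *\<^sub>R axis i 1)" "b' x"] assms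
    by (auto simp: partial_on_def)
qed

lemma partial_on_compose:
  assumes "partial_on U i f f'" "\<And>x. x \<in> U \<Longrightarrow> (k has_field_derivative k' x) (at (f x))"
  shows "partial_on U i (\<lambda>x. k (f x)) (\<lambda>x. k' x * f' x)"
  unfolding partial_on_def
proof
  fix x assume x: "x \<in> U"
  show "((\<lambda>h. k (f (x + h *\<^sub>R axis i 1))) has_field_derivative (k' x * f' x)) (at 0)"
    using DERIV_chain2[of k "k' x" "\<lambda>h. f (x + h *\<^sub>R axis i 1)" 0 "f' x" UNIV] assms x
    by (auto simp: partial_on_def)
qed

lemma partial_on_const: "partial_on U i (\<lambda>x. c) (\<lambda>x. 0)"
  by (auto simp: partial_on_def)

lemma C_infinity_partial_on:
  assumes "C_infinity_on U f"
  shows "partial_on U i f (partial_deriv i f)"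
proof -
  have "\<forall>x\<in>U. (\<lambda>h. f (x + h *\<^sub>R axis i 1)) field_differentiable (at 0)"
    using assms unfolding C_infinity_on_def by (metis iter_partial.simps(1))
  then show ?thesis
    by (auto simp: partial_on_def partial_deriv_def DERIV_deriv_iff_field_differentiable)
qed

lemma C_infinity_continuous_on: "C_infinity_on U f \<Longrightarrow> continuous_on U f"
  unfolding C_infinity_on_def by (metis iter_partial.simps(1))

lemma C_infinity_iter_partial: "C_infinity_on U f \<Longrightarrow> C_infinity_on U (iter_partial js f)"
  unfolding C_infinity_on_def by (metis iter_partial_append)

lemma C_infinity_partial_deriv: "C_infinity_on U f \<Longrightarrow> C_infinity_on U (partial_deriv i f)"
  using C_infinity_iter_partial[of U f "[i]"] by simp

text \<open>
  A family of functions that is closed under partial differentiation contains, up to values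
  outside \<open>U\<close>, all iterated derivatives of its members. This identifies derivatives of every order
  without any explicit formula for them, and it yields smoothness in the coinduction principle
  below.
\<close>

lemma iter_partial_in_family:
  assumes "open U" "f \<in> F"
    and closed: "\<And>a i. a \<in> F \<Longrightarrow> \<exists>b\<in>F. partial_on U i a b"
  shows "\<exists>b\<in>F. \<forall>x\<in>U. iter_partial is f x = b x"
proof (induction "is")
  case Nil
  then show ?case using assms by auto
next
  case (Cons i "is")
  then obtain a where a: "a \<in> F" "\<And>x. x \<in> U \<Longrightarrow> iter_partial is f x = a x" by auto
  obtain b where b: "b \<in> F" "partial_on U i a b" using closed a(1) by blast
  have "partial_on U i (iter_partial is f) b"
    by (rule partial_on_cong[OF assms(1) b(2)]) (use a in auto)
  from partial_on_imp_eq[OF this] show ?case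
    by (intro bexI[OF _ b(1)]) simp
qed

lemma C_infinity_coinduct:
  assumes "open U" "f \<in> F"
    and cont: "\<And>a. a \<in> F \<Longrightarrow> continuous_on U a"
    and closed: "\<And>a i. a \<in> F \<Longrightarrow> \<exists>b\<in>F. partial_on U i a b"
  shows "C_infinity_on U f"
  unfolding C_infinity_on_def
proof (intro allI conjI ballI)
  fix "is"
  obtain a where a: "a \<in> F" "\<And>x. x \<in> U \<Longrightarrow> iter_partial is f x = a x"
    using iter_partial_in_family[OF assms(1,2) closed] by blast
  show "continuous_on U (iter_partial is f)"
    using cont[OF a(1)] a(2) continuous_on_cong by force
  fix i x assume x: "x \<in> U"
  obtain b where b: "partial_on U i a b" using closed a(1) by blast
  have "partial_on U i (iter_partial is f) b"
    by (rule partial_on_cong[OF assms(1) b]) (use a in auto)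
  then show "(\<lambda>h. iter_partial is f (x + h *\<^sub>R axis i 1)) field_differentiable (at 0)"
    using x by (auto simp: partial_on_def field_differentiable_def)
qed

text \<open>Coinduction with the smooth functions together with \<open>f\<close> itself as the family.\<close>

lemma C_infinity_from_partials:
  assumes "open U" "continuous_on U f" "\<And>i. partial_on U i f (f' i)" "\<And>i. C_infinity_on U (f' i)"
  shows "C_infinity_on U f"
proof (rule C_infinity_coinduct[where F = "insert f {a. C_infinity_on U a}"])
  fix a i assume "a \<in> insert f {a. C_infinity_on U a}"
  then show "\<exists>b\<in>insert f {a. C_infinity_on U a}. partial_on U i a b"
    using assms C_infinity_partial_on C_infinity_partial_deriv by blast
qed (use assms C_infinity_continuous_on in auto)

lemma C_infinity_cong:
  assumes "open U" "\<And>x. x \<in> U \<Longrightarrow> f x = g x" "C_infinity_on U f"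
  shows "C_infinity_on U g"
proof (rule C_infinity_from_partials[OF assms(1)])
  show "continuous_on U g"
    using C_infinity_continuous_on[OF assms(3)] assms(2) continuous_on_cong by force
  show "partial_on U i g (partial_deriv i f)" for i
    by (rule partial_on_cong[OF assms(1) C_infinity_partial_on[OF assms(3)]]) (use assms(2) in auto)
qed (rule C_infinity_partial_deriv[OF assms(3)])

lemma C_infinity_const: "open U \<Longrightarrow> C_infinity_on U (\<lambda>x. c)"
  by (rule C_infinity_coinduct[where F = "range (\<lambda>c x. c)"]) (auto intro: partial_on_const)

text \<open>
  A family to which \<open>C_infinity_coinduct\<close> applies: the product rule and the rule for
  \<open>\<partial>(1/f) = - (1/f)\<^sup>2 \<partial>f\<close> lead out of the smooth functions only by sums and products. It yields
  at once the smoothness of products and, for nonvanishing \<open>f\<close>, of \<open>1/f\<close>.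
\<close>

inductive_set adjoin_inverse :: "(real ^ 'n) set \<Rightarrow> (real ^ 'n \<Rightarrow> real) \<Rightarrow> (real ^ 'n \<Rightarrow> real) set"
  for U f where
  base: "C_infinity_on U a \<Longrightarrow> a \<in> adjoin_inverse U f"
| inv: "(\<lambda>x. inverse (f x)) \<in> adjoin_inverse U f"
| add: "a \<in> adjoin_inverse U f \<Longrightarrow> b \<in> adjoin_inverse U f \<Longrightarrow>
    (\<lambda>x. a x + b x) \<in> adjoin_inverse U f"
| mult: "a \<in> adjoin_inverse U f \<Longrightarrow> b \<in> adjoin_inverse U f \<Longrightarrow>
    (\<lambda>x. a x * b x) \<in> adjoin_inverse U f"

lemma adjoin_inverse_smooth:
  assumes U: "open U" and f: "C_infinity_on U f" and nz: "\<And>x. x \<in> U \<Longrightarrow> f x \<noteq> 0"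
    and g: "g \<in> adjoin_inverse U f"
  shows "C_infinity_on U g"
proof (rule C_infinity_coinduct[OF U g])
  fix a assume "a \<in> adjoin_inverse U f"
  then show "continuous_on U a"
  proof induction
    case (base a)
    then show ?case by (rule C_infinity_continuous_on)
  next
    case inv
    show ?case using nz by (intro continuous_on_inverse C_infinity_continuous_on f) blast
  qed (intro continuous_on_add continuous_on_mult; assumption)+
next
  fix a i assume "a \<in> adjoin_inverse U f"
  then show "\<exists>b\<in>adjoin_inverse U f. partial_on U i a b"
  proof induction
    case (base a)
    then show ?case
      using C_infinity_partial_on C_infinity_partial_deriv adjoin_inverse.base by blast
  next
    case inv
    have "partial_on U i (\<lambda>x. inverse (f x))
        (\<lambda>x. - (inverse (f x) ^ Suc (Suc 0)) * partial_deriv i f x)"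
      by (rule partial_on_compose[OF C_infinity_partial_on[OF f]])
         (rule DERIV_inverse[OF nz])
    also have "(\<lambda>x. - (inverse (f x) ^ Suc (Suc 0)) * partial_deriv i f x) =
        (\<lambda>x. inverse (f x) * inverse (f x) * (- 1 * partial_deriv i f x))"
      by simp
    finally show ?case
      by (rule bexI[where P = "partial_on U i (\<lambda>x. inverse (f x))"])
         (intro adjoin_inverse.mult adjoin_inverse.inv adjoin_inverse.base[OF C_infinity_const[OF U]]
          adjoin_inverse.base[OF C_infinity_partial_deriv[OF f]])
  next
    case (add a b)
    then obtain a' b' where "a' \<in> adjoin_inverse U f" "b' \<in> adjoin_inverse U f"
      "partial_on U i a a'" "partial_on U i b b'" by blast
    then show ?case
      by (intro bexI[of _ "\<lambda>x. a' x + b' x"] partial_on_add adjoin_inverse.add)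
  next
    case (mult a b)
    then obtain a' b' where "a' \<in> adjoin_inverse U f" "b' \<in> adjoin_inverse U f"
      "partial_on U i a a'" "partial_on U i b b'" by blast
    with mult.hyps show ?case
      by (intro bexI[of _ "\<lambda>x. a' x * b x + b' x * a x"] partial_on_mult
          adjoin_inverse.add adjoin_inverse.mult)
  qed
qed

lemma C_infinity_mult:
  assumes "open U" "C_infinity_on U a" "C_infinity_on U b"
  shows "C_infinity_on U (\<lambda>x. a x * b x)"
  by (rule adjoin_inverse_smooth[OF assms(1) C_infinity_const[OF assms(1), of 1]])
     (simp_all add: adjoin_inverse.mult adjoin_inverse.base assms)

lemma C_infinity_ln:
  assumes U: "open U" and f: "C_infinity_on U f" and pos: "\<And>x. x \<in> U \<Longrightarrow> f x > 0"
  shows "C_infinity_on U (\<lambda>x. ln (f x))"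
proof (rule C_infinity_from_partials[OF U])
  show "continuous_on U (\<lambda>x. ln (f x))"
    using pos by (intro continuous_on_ln C_infinity_continuous_on f) force
  show "partial_on U i (\<lambda>x. ln (f x)) (\<lambda>x. inverse (f x) * partial_deriv i f x)" for i
    by (rule partial_on_compose[OF C_infinity_partial_on[OF f]]) (use pos in \<open>auto intro!: DERIV_ln\<close>)
  show "C_infinity_on U (\<lambda>x. inverse (f x) * partial_deriv i f x)" for i
    by (rule adjoin_inverse_smooth[OF U f])
       (use pos in \<open>force intro: adjoin_inverse.mult adjoin_inverse.inv adjoin_inverse.base
         C_infinity_partial_deriv f\<close>)+
qed

lemma iter_partial_add_cmult:
  assumes "open U" "C_infinity_on U a" "C_infinity_on U b" "x \<in> U"
  shows "iter_partial is (\<lambda>x. a x + c * b x) x = iter_partial is a x + c * iter_partial is b x"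
  using assms(4)
proof (induction "is" arbitrary: x)
  case (Cons i "is")
  have "partial_on U i (iter_partial is a) (iter_partial (i # is) a)"
    "partial_on U i (iter_partial is b) (iter_partial (i # is) b)"
    using assms by (auto intro!: C_infinity_partial_on C_infinity_iter_partial)
  then have "partial_on U i (\<lambda>x. iter_partial is a x + c * iter_partial is b x)
     (\<lambda>x. iter_partial (i # is) a x + (0 * iter_partial is b x + iter_partial (i # is) b x * c))"
    by (intro partial_on_add partial_on_mult partial_on_const)
  then have "partial_on U i (iter_partial is (\<lambda>x. a x + c * b x))
     (\<lambda>x. iter_partial (i # is) a x + c * iter_partial (i # is) b x)"
    by (rule partial_on_cong[OF assms(1)]) (use Cons.IH in auto)
  from partial_on_imp_eq[OF this Cons.prems] show ?case by simp
qed simp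

text \<open>
  The case in mind is \<open>g n = exp (\<epsilon> n * \<psi>)\<close>, used only through its derivative. Splitting off the
  innermost derivative, \<open>\<partial>\<^sub>i (a g\<^sub>n) = (\<partial>\<^sub>i a) g\<^sub>n + \<epsilon>\<^sub>n (a \<partial>\<^sub>i\<psi>) g\<^sub>n\<close>, leaves two products of the same shape
  with one derivative fewer, and the second one carries a null factor. The induction therefore
  runs over all smooth \<open>a\<close> simultaneously and peels the list of directions from its right end.
\<close>

lemma iter_partial_mult_tendsto:
  fixes \<epsilon> :: "nat \<Rightarrow> real"
  assumes U: "open U" and \<psi>: "C_infinity_on U \<psi>" and g: "\<And>n. C_infinity_on U (g n)"
    and dg: "\<And>n i. partial_on U i (g n) (\<lambda>x. \<epsilon> n * (partial_deriv i \<psi> x * g n x))"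
    and eps: "\<epsilon> \<longlonglongrightarrow> 0" and g1: "\<And>x. x \<in> U \<Longrightarrow> (\<lambda>n. g n x) \<longlonglongrightarrow> 1"
    and "x \<in> U" "C_infinity_on U a"
  shows "(\<lambda>n. iter_partial is (\<lambda>x. a x * g n x) x) \<longlonglongrightarrow> iter_partial is a x"
  using assms(8)
proof (induction "is" arbitrary: a rule: rev_induct)
  case Nil
  show ?case using tendsto_mult[OF tendsto_const g1[OF \<open>x \<in> U\<close>], of "a x"] by simp
next
  case (snoc i "is")
  let ?b = "\<lambda>x. a x * partial_deriv i \<psi> x"
  have a': "C_infinity_on U (partial_deriv i a)" and b: "C_infinity_on U ?b"
    by (intro C_infinity_mult U snoc.prems C_infinity_partial_deriv \<psi>)+
  have eq: "iter_partial (is @ [i]) (\<lambda>x. a x * g n x) x =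
      iter_partial is (\<lambda>x. partial_deriv i a x * g n x) x +
      \<epsilon> n * iter_partial is (\<lambda>x. ?b x * g n x) x" for n
  proof -
    have "iter_partial (is @ [i]) (\<lambda>x. a x * g n x) x =
        iter_partial is (\<lambda>x. partial_deriv i a x * g n x + \<epsilon> n * (?b x * g n x)) x"
      unfolding iter_partial_append iter_partial.simps
    proof (rule iter_partial_cong[OF U _ \<open>x \<in> U\<close>])
      fix y assume "y \<in> U"
      from partial_on_imp_eq[OF partial_on_mult[OF C_infinity_partial_on[OF snoc.prems] dg] this]
      show "partial_deriv i (\<lambda>x. a x * g n x) y =
          partial_deriv i a y * g n y + \<epsilon> n * (?b y * g n y)"
        by (simp add: algebra_simps)
    qed
    also have "\<dots> = iter_partial is (\<lambda>x. partial_deriv i a x * g n x) x +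
      \<epsilon> n * iter_partial is (\<lambda>x. ?b x * g n x) x"
      by (intro iter_partial_add_cmult[OF U _ _ \<open>x \<in> U\<close>] C_infinity_mult[OF U] a' b g)
    finally show ?thesis .
  qed
  have "(\<lambda>n. iter_partial is (\<lambda>x. partial_deriv i a x * g n x) x +
      \<epsilon> n * iter_partial is (\<lambda>x. ?b x * g n x) x) \<longlonglongrightarrow>
      iter_partial is (partial_deriv i a) x + 0 * iter_partial is ?b x"
    by (intro tendsto_add tendsto_mult eps snoc.IH a' b)
  then show ?case unfolding eq by (simp add: iter_partial_append)
qed

section \<open>Laplace transforms of probability measures on the orthant\<close>

lemma open_all_components_less: "open {x :: real ^ 'n. \<forall>j. x $ j < c}"
proof -
  have "open (\<Inter>j. {x :: real ^ 'n. x $ j < c})"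
    by (intro open_INT finite_class.finite_UNIV ballI open_Collect_less continuous_intros)
  also have "(\<Inter>j. {x :: real ^ 'n. x $ j < c}) = {x. \<forall>j. x $ j < c}" by blast
  finally show ?thesis .
qed

lemma open_neg_orthant: "open (neg_orthant :: (real ^ 'n) set)"
  unfolding neg_orthant_def by (rule open_all_components_less)

text \<open>
  The distance \<open>2\<delta>\<close> from the boundary leaves \<open>\<delta>\<close> for moving the point and \<open>\<delta>\<close> for a uniform bound
  on the integrands.
\<close>

lemma neg_orthant_margin:
  assumes "s \<in> neg_orthant"
  obtains \<delta> where "0 < \<delta>" "\<forall>j. s $ j \<le> - (2 * \<delta>)"
proof
  let ?m = "Max (range (\<lambda>j. s $ j))"
  have "?m < 0" using assms by (simp add: neg_orthant_def)
  then show "0 < - ?m / 2" by linarith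
  have "s $ j \<le> ?m" for j by simp
  then show "\<forall>j. s $ j \<le> - (2 * (- ?m / 2))"
    by (intro allI) (simp only: times_divide_eq_right nonzero_mult_div_cancel_left
        numeral_neq_zero minus_minus not_False_eq_True)
qed

lemma inner_nonpos:
  assumes "\<And>j. s $ j \<le> 0" "u \<in> nonneg_orthant"
  shows "s \<bullet> u \<le> (0::real)"
  using assms unfolding inner_vec_def nonneg_orthant_def
  by (auto intro!: sum_nonpos mult_nonpos_nonneg)

definition moment_integrand :: "'n list \<Rightarrow> real ^ 'n \<Rightarrow> real ^ 'n \<Rightarrow> real" where
  "moment_integrand is s u = (\<Prod>i\<leftarrow>is. u $ i) * exp (s \<bullet> u)"

lemma moment_integrand_nonneg:
  assumes "u \<in> nonneg_orthant"
  shows "0 \<le> moment_integrand is s u"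
proof -
  have "0 \<le> (\<Prod>i\<leftarrow>is. u $ i)"
    using assms by (induction "is") (auto simp: nonneg_orthant_def)
  then show ?thesis by (simp add: moment_integrand_def)
qed

lemma moment_integrand_shift:
  "moment_integrand is (s + h *\<^sub>R axis i 1) u = exp (h * u $ i) * moment_integrand is s u"
  by (simp add: moment_integrand_def inner_add_left inner_axis' exp_add)

lemma moment_integrand_Cons: "moment_integrand (i # is) s u = u $ i * moment_integrand is s u"
  by (simp add: moment_integrand_def)

text \<open>
  Exponential decay beats monomials: half of the rate \<open>\<delta>\<close> is spent on each factor \<open>u $ i\<close>, by
  \<open>u $ i * exp (- (\<delta>/2) * u $ i) \<le> 2/\<delta>\<close>. The constant bounds serve as dominating functions
  below, as the measure is finite.
\<close>

lemma moment_integrand_bounded: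
  fixes \<delta> :: real and "is" :: "('n::finite) list"
  assumes "0 < \<delta>"
  shows "\<exists>C. \<forall>s u. (\<forall>j. s $ j \<le> - \<delta>) \<longrightarrow> u \<in> nonneg_orthant \<longrightarrow> moment_integrand is s u \<le> C"
  using assms
proof (induction "is" arbitrary: \<delta>)
  case Nil
  have "moment_integrand [] s u \<le> 1" if "\<forall>j. s $ j \<le> - \<delta>" "u \<in> nonneg_orthant" for s u :: "real ^ 'n"
  proof -
    have "s $ j \<le> 0" for j using that(1)[rule_format, of j] Nil by linarith
    then show ?thesis using inner_nonpos[of s u] that(2) by (simp add: moment_integrand_def)
  qed
  then show ?case by blast
next
  case (Cons i "is")
  obtain C where C: "\<And>s u. (\<forall>j. s $ j \<le> - (\<delta>/2)) \<Longrightarrow> u \<in> nonneg_orthant \<Longrightarrow>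
      moment_integrand is s u \<le> C"
    using Cons.IH[of "\<delta>/2"] Cons.prems by auto
  have "moment_integrand (i # is) s u \<le> 2 / \<delta> * C"
    if s: "\<forall>j. s $ j \<le> - \<delta>" and u: "u \<in> nonneg_orthant" for s u :: "real ^ 'n"
  proof -
    define s' where "s' = s + (\<delta>/2) *\<^sub>R axis i 1"
    have "\<forall>j. s' $ j \<le> - (\<delta>/2)"
    proof
      fix j show "s' $ j \<le> - (\<delta>/2)"
        using s[rule_format, of j] Cons.prems by (auto simp: s'_def axis_def)
    qed
    then have 1: "moment_integrand is s' u \<le> C" using C u by blast
    have "moment_integrand is s u = exp (- (\<delta>/2) * u $ i) * moment_integrand is s' u"
      using moment_integrand_shift[of "is" s' "- (\<delta>/2)" i u] by (simp add: s'_def)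
    then have eq: "moment_integrand (i # is) s u =
        (u $ i * exp (- (\<delta>/2) * u $ i)) * moment_integrand is s' u"
      by (simp add: moment_integrand_Cons)
    have "\<delta>/2 * u $ i \<le> exp (\<delta>/2 * u $ i)"
      using exp_ge_add_one_self[of "\<delta>/2 * u $ i"] by linarith
    then have 2: "u $ i * exp (- (\<delta>/2) * u $ i) \<le> 2 / \<delta>"
      using Cons.prems by (simp add: exp_minus field_simps)
    show ?thesis
      unfolding eq using 1 2 moment_integrand_nonneg[OF u, of "is" s'] Cons.prems
      by (intro mult_mono) auto
  qed
  then show ?case by blast
qed

locale orthant_prob = prob_space Q for Q :: "(real ^ 'n) measure" +
  assumes sets_Q: "sets Q = sets orthant_space"
begin

lemma space_Q: "space Q = nonneg_orthant"
  using sets_eq_imp_space_eq[OF sets_Q] by (simp add: orthant_space_def space_restrict_space)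

lemma borel_measurable_Q: "f \<in> borel_measurable borel \<Longrightarrow> f \<in> borel_measurable Q"
  using measurable_cong_sets[OF sets_Q refl] measurable_restrict_space1
  unfolding orthant_space_def by blast

lemma moment_integrand_measurable: "moment_integrand is s \<in> borel_measurable Q"
proof (rule borel_measurable_Q, rule borel_measurable_continuous_onI)
  have "continuous_on UNIV (\<lambda>u :: real ^ 'n. \<Prod>i\<leftarrow>is. u $ i)"
    by (induction "is") (auto intro!: continuous_intros)
  then show "continuous_on UNIV (moment_integrand is s)"
    unfolding moment_integrand_def by (intro continuous_intros)
qed

definition moment :: "'n list \<Rightarrow> real ^ 'n \<Rightarrow> real" where
  "moment is s = (\<integral>u. moment_integrand is s u \<partial>Q)"

lemma integrable_moment:
  assumes "s \<in> neg_orthant"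
  shows "integrable Q (moment_integrand is s)"
proof -
  obtain \<delta> where \<delta>: "0 < \<delta>" "\<forall>j. s $ j \<le> - (2 * \<delta>)"
    using neg_orthant_margin[OF assms] .
  then obtain C where "\<And>u. u \<in> nonneg_orthant \<Longrightarrow> moment_integrand is s u \<le> C"
    using moment_integrand_bounded[of "2 * \<delta>" "is"] by auto
  then show ?thesis
    by (intro integrable_const_bound[of _ C] moment_integrand_measurable AE_I2)
       (simp add: moment_integrand_nonneg space_Q)
qed

lemma moment_nonneg: "0 \<le> moment is s"
  unfolding moment_def using space_Q by (intro integral_nonneg_AE AE_I2 moment_integrand_nonneg) auto

lemma continuous_on_moment: "continuous_on neg_orthant (moment is)"
proof -
  have "continuous (at s) (moment is)" if s: "s \<in> neg_orthant" for s
  proof -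
    obtain \<delta> where \<delta>: "0 < \<delta>" "\<forall>j. s $ j \<le> - (2 * \<delta>)"
      using neg_orthant_margin[OF s] .
    define V where "V = {s :: real ^ 'n. \<forall>j. s $ j < - \<delta>}"
    have "s $ j < - \<delta>" for j using \<delta>(2)[rule_format, of j] \<delta>(1) by linarith
    then have V: "open V" "s \<in> V"
      unfolding V_def by (simp_all add: open_all_components_less)
    obtain C where "\<And>s u. \<forall>j. s $ j \<le> - \<delta> \<Longrightarrow> u \<in> nonneg_orthant \<Longrightarrow>
        moment_integrand is s u \<le> C"
      using moment_integrand_bounded[OF \<delta>(1), of "is"] by blast
    then have C: "moment_integrand is s u \<le> C" if "s \<in> V" "u \<in> nonneg_orthant" for s u
      using that by (simp add: V_def less_imp_le)
    have "continuous (at s within V) (moment is)"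
      unfolding continuous_within_sequentially o_def moment_def
    proof (intro allI impI, elim conjE)
      fix X assume X: "\<forall>n. X n \<in> V" "X \<longlonglongrightarrow> s"
      show "(\<lambda>n. \<integral>u. moment_integrand is (X n) u \<partial>Q) \<longlonglongrightarrow> (\<integral>u. moment_integrand is s u \<partial>Q)"
      proof (rule integral_dominated_convergence[where w = "\<lambda>_. C"])
        show "AE u in Q. (\<lambda>n. moment_integrand is (X n) u) \<longlonglongrightarrow> moment_integrand is s u"
          unfolding moment_integrand_def using X(2) by (intro AE_I2 tendsto_intros)
        show "AE u in Q. norm (moment_integrand is (X n) u) \<le> C" for n
          using C X(1) by (intro AE_I2) (simp add: moment_integrand_nonneg space_Q)
      qed (auto intro: moment_integrand_measurable)
    qed
    then show ?thesis using at_within_open[OF V(2,1)] by simp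
  qed
  then show ?thesis by (simp add: continuous_at_imp_continuous_on)
qed

text \<open>
  Differentiation under the integral sign. By \<open>\<bar>exp y - 1\<bar> \<le> \<bar>y\<bar> exp \<bar>y\<bar>\<close>, the difference quotients
  of an integrand are dominated by the next integrand at a shifted point that is still at distance
  \<open>\<delta>\<close> from the boundary, hence by a constant.
\<close>

lemma partial_on_moment: "partial_on neg_orthant i (moment is) (moment (i # is))"
  unfolding partial_on_def
proof
  fix s :: "real ^ 'n" assume s: "s \<in> neg_orthant"
  obtain \<delta> where \<delta>: "0 < \<delta>" and s2: "\<forall>j. s $ j \<le> - (2 * \<delta>)"
    using neg_orthant_margin[OF s] .
  have near: "s + h *\<^sub>R axis i 1 \<in> neg_orthant" "\<forall>j. (s + h *\<^sub>R axis i 1) $ j \<le> - \<delta>"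
    if "\<bar>h\<bar> < \<delta>" for h
  proof -
    show *: "\<forall>j. (s + h *\<^sub>R axis i 1) $ j \<le> - \<delta>"
    proof
      fix j show "(s + h *\<^sub>R axis i 1) $ j \<le> - \<delta>"
        using s2[rule_format, of j] that \<delta> by (auto simp: axis_def)
    qed
    have "(s + h *\<^sub>R axis i 1) $ j < 0" for j using *[rule_format, of j] \<delta> by linarith
    then show "s + h *\<^sub>R axis i 1 \<in> neg_orthant"
      unfolding neg_orthant_def by blast
  qed
  obtain C where C: "\<And>s u. \<forall>j. s $ j \<le> - \<delta> \<Longrightarrow> u \<in> nonneg_orthant \<Longrightarrow>
      moment_integrand (i # is) s u \<le> C"
    using moment_integrand_bounded[OF \<delta>, of "i # is"] by blast
  define q where "q h u = (moment_integrand is (s + h *\<^sub>R axis i 1) u - moment_integrand is s u) / h"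
    for h u
  have q_integral: "(moment is (s + h *\<^sub>R axis i 1) - moment is s) / h = (\<integral>u. q h u \<partial>Q)"
    if "\<bar>h\<bar> < \<delta>" for h
    unfolding q_def moment_def using integrable_moment near(1)[OF that] s by simp
  have q_bound: "\<bar>q h u\<bar> \<le> C" if h: "\<bar>h\<bar> < \<delta>" "h \<noteq> 0" and u: "u \<in> nonneg_orthant" for h u
  proof -
    have ui: "0 \<le> u $ i" using u by (auto simp: nonneg_orthant_def)
    have q: "q h u = (exp (h * u $ i) - 1) / h * moment_integrand is s u"
      by (simp add: q_def moment_integrand_shift algebra_simps diff_divide_distrib)
    have "\<bar>exp y - 1\<bar> \<le> \<bar>y\<bar> * exp \<bar>y\<bar>" for y :: real
    proof (cases "y \<ge> 0")
      case True
      have "exp y * (1 - y) \<le> exp y * exp (- y)"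
        using exp_ge_add_one_self[of "- y"] by (intro mult_left_mono) auto
      then show ?thesis using True by (simp add: exp_minus algebra_simps)
    next
      case False
      have "1 - exp y \<le> - y" using exp_ge_add_one_self[of y] by linarith
      also have "\<dots> \<le> - y * exp (- y)"
        using False mult_left_mono[of 1 "exp (- y)" "- y"] by auto
      finally show ?thesis using False by auto
    qed
    from this[of "h * u $ i"] have "\<bar>(exp (h * u $ i) - 1) / h\<bar> \<le> u $ i * exp (\<bar>h\<bar> * u $ i)"
      using h(2) ui by (simp add: abs_mult field_simps)
    then have "\<bar>q h u\<bar> \<le> u $ i * exp (\<bar>h\<bar> * u $ i) * moment_integrand is s u"
      unfolding q abs_mult using moment_integrand_nonneg[OF u, of "is" s] ui
      by (intro mult_mono) auto
    also have "\<dots> = moment_integrand (i # is) (s + \<bar>h\<bar> *\<^sub>R axis i 1) u"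
      by (simp add: moment_integrand_Cons moment_integrand_shift)
    also have "\<dots> \<le> C" using near[of "\<bar>h\<bar>"] h u by (intro C) auto
    finally show ?thesis .
  qed
  have q_lim: "((\<lambda>h. q h u) \<longlongrightarrow> moment_integrand (i # is) s u) (at 0)" for u
  proof -
    have "((\<lambda>h. moment_integrand is (s + h *\<^sub>R axis i 1) u) has_field_derivative
        moment_integrand (i # is) s u) (at 0)"
      unfolding moment_integrand_shift moment_integrand_Cons
      by (auto intro!: derivative_eq_intros)
    then show ?thesis by (simp add: DERIV_def q_def)
  qed
  have "((\<lambda>h. (moment is (s + h *\<^sub>R axis i 1) - moment is s) / h) \<longlongrightarrow> moment (i # is) s)
      (at 0 within ball 0 \<delta>)"
    unfolding tendsto_at_iff_sequentially o_def
  proof (intro allI impI)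
    fix X assume X: "\<forall>n. X n \<in> ball 0 \<delta> - {0}" "X \<longlonglongrightarrow> (0::real)"
    then have X': "\<bar>X n\<bar> < \<delta>" "X n \<noteq> 0" for n by auto
    have "(\<lambda>n. \<integral>u. q (X n) u \<partial>Q) \<longlonglongrightarrow> (\<integral>u. moment_integrand (i # is) s u \<partial>Q)"
    proof (rule integral_dominated_convergence[where w = "\<lambda>_. C"])
      show "AE u in Q. (\<lambda>n. q (X n) u) \<longlonglongrightarrow> moment_integrand (i # is) s u"
      proof (rule AE_I2)
        fix u
        have "filterlim X (at 0) sequentially"
          using X X' by (auto simp: filterlim_at)
        from filterlim_compose[OF q_lim this]
        show "(\<lambda>n. q (X n) u) \<longlonglongrightarrow> moment_integrand (i # is) s u" .
      qed
      show "AE u in Q. norm (q (X n) u) \<le> C" for n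
        using q_bound[OF X'] space_Q by (intro AE_I2) auto
      show "q (X n) \<in> borel_measurable Q" for n
        unfolding q_def
        by (intro borel_measurable_divide borel_measurable_diff moment_integrand_measurable) auto
    qed (auto intro: moment_integrand_measurable)
    then show "(\<lambda>n. (moment is (s + X n *\<^sub>R axis i 1) - moment is s) / X n) \<longlonglongrightarrow> moment (i # is) s"
      using q_integral[OF X'(1)] by (simp add: moment_def)
  qed
  then show "((\<lambda>h. moment is (s + h *\<^sub>R axis i 1)) has_field_derivative moment (i # is) s) (at 0)"
    using \<delta> at_within_open[of "0::real" "ball 0 \<delta>"] by (simp add: DERIV_def)
qed

lemma laplace_transform_eq_moment: "laplace_transform Q = moment []"
  by (auto simp: laplace_transform_def moment_def moment_integrand_def)

text \<open>The moments form a family that is closed under partial differentiation, and they are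
  nonnegative.\<close>

lemma absolutely_monotone_laplace: "absolutely_monotone (laplace_transform Q)"
  unfolding absolutely_monotone_def laplace_transform_eq_moment
proof (intro conjI allI ballI)
  have closed: "\<exists>b\<in>range moment. partial_on neg_orthant i a b" if "a \<in> range moment" for a i
    using that partial_on_moment by blast
  show "C_infinity_on neg_orthant (moment [])"
    by (rule C_infinity_coinduct[OF open_neg_orthant _ _ closed]) (auto intro: continuous_on_moment)
  fix "is" and x :: "real ^ 'n" assume "x \<in> neg_orthant"
  then show "0 \<le> iter_partial is (moment []) x"
    using iter_partial_in_family[OF open_neg_orthant _ closed, of "moment []" "is"] moment_nonneg
    by fastforce
qed

lemma integrable_exp_inner: "s \<in> neg_orthant \<Longrightarrow> integrable Q (\<lambda>u. exp (s \<bullet> u))"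
  using integrable_moment[of s "[]"] by (simp add: moment_integrand_def[abs_def])

lemma laplace_transform_pos:
  assumes "s \<in> neg_orthant"
  shows "0 < laplace_transform Q s"
  unfolding laplace_transform_def
  using integral_less_AE_space[of "\<lambda>_. 0" "\<lambda>u. exp (s \<bullet> u)"] integrable_exp_inner[OF assms]
  by (simp add: emeasure_space_1)

lemma laplace_transform_le_1:
  assumes "s \<in> neg_orthant"
  shows "laplace_transform Q s \<le> 1"
proof -
  have "exp (s \<bullet> u) \<le> 1" if "u \<in> space Q" for u
    using inner_nonpos[of s u] that assms space_Q by (simp add: neg_orthant_def less_imp_le)
  then have "laplace_transform Q s \<le> (\<integral>u. 1 \<partial>Q)"
    unfolding laplace_transform_def
    by (intro integral_mono_AE integrable_exp_inner assms) auto
  then show ?thesis by (simp add: prob_space)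
qed

lemma nn_integral_exp_inner:
  "s \<in> neg_orthant \<Longrightarrow> (\<integral>\<^sup>+u. ennreal (exp (s \<bullet> u)) \<partial>Q) = ennreal (laplace_transform Q s)"
  unfolding laplace_transform_def by (intro nn_integral_eq_integral integrable_exp_inner) auto

end

section \<open>The convolution semigroup\<close>

lemma increment_laws_orthant_prob:
  assumes "increment_laws K P" "0 < t"
  shows "orthant_prob (P t)"
  using assms unfolding increment_laws_def orthant_prob_def orthant_prob_axioms_def
  by (auto simp: space_prob_algebra)

lemma laplace_transform_semigroup:
  fixes P :: "real \<Rightarrow> (real ^ 'n) measure"
  assumes "homogeneous_markov_process M \<xi> K" "increment_laws K P" "0 < t" "0 < r"
    and s: "s \<in> neg_orthant"
  shows "laplace_transform (P (t + r)) s = laplace_transform (P t) s * laplace_transform (P r) s"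
proof -
  interpret homogeneous_markov_process M \<xi> K by fact
  interpret Pt: orthant_prob "P t" using increment_laws_orthant_prob assms by blast
  interpret Pr: orthant_prob "P r" using increment_laws_orthant_prob assms by blast
  interpret Ptr: orthant_prob "P (t + r)" using increment_laws_orthant_prob[OF assms(2)] assms by simp
  have sp: "space orthant_space = (nonneg_orthant :: (real ^ 'n) set)"
    by (simp add: orthant_space_def space_restrict_space)
  \<comment> \<open>Started at the origin, the process has \<open>P d\<close> itself as its law at time \<open>d\<close>.\<close>
  have zero: "(0 :: real ^ 'n) \<in> nonneg_orthant" by (simp add: nonneg_orthant_def)
  have K: "K a (a + d) x = distr (P d) orthant_space (\<lambda>u. x + u)"
    if "0 < d" "0 \<le> a" "x \<in> nonneg_orthant" for a d x
    using assms(2) that unfolding increment_laws_def by blast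
  have K0: "K 0 d 0 = P d" if "orthant_prob (P d)" "0 < d" for d
    using K[OF that(2) _ zero, of 0] orthant_prob.sets_Q[OF that(1)]
      distr_id2[of "orthant_space" "P d"] by simp
  have CK: "P (t + r) = Giry_Monad.bind (P t) (K t (t + r))"
    using Chapman_Kolmogorov[of 0 t "t + r" 0] assms(3,4) zero sp
    by (simp add: K0 Pt.orthant_prob_axioms Ptr.orthant_prob_axioms)
  have meas: "(\<lambda>u. ennreal (exp (s \<bullet> u))) \<in> borel_measurable orthant_space"
    unfolding orthant_space_def by (intro measurable_restrict_space1) measurable
  have kern: "K t (t + r) \<in> measurable (P t) (subprob_algebra orthant_space)"
    using measurable_prob_algebraD[OF kernel[of t "t + r"]] assms(3,4)
      measurable_cong_sets[OF Pt.sets_Q refl] by auto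
  have inner: "(\<integral>\<^sup>+v. ennreal (exp (s \<bullet> v)) \<partial>K t (t + r) x) =
      ennreal (exp (s \<bullet> x)) * ennreal (laplace_transform (P r) s)" if x: "x \<in> nonneg_orthant" for x
  proof -
    have "(\<lambda>u. x + u) \<in> measurable (P r) orthant_space"
      unfolding measurable_cong_sets[OF Pr.sets_Q refl] unfolding orthant_space_def
      using x by (intro measurable_restrict_space3) (auto simp: nonneg_orthant_def)
    then have "(\<integral>\<^sup>+v. ennreal (exp (s \<bullet> v)) \<partial>K t (t + r) x) =
        (\<integral>\<^sup>+u. ennreal (exp (s \<bullet> x)) * ennreal (exp (s \<bullet> u)) \<partial>P r)"
      using K[of r t x] assms(3,4) x meas
      by (simp add: nn_integral_distr inner_add_right exp_add ennreal_mult)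
    also have "\<dots> = ennreal (exp (s \<bullet> x)) * ennreal (laplace_transform (P r) s)"
      using meas measurable_cong_sets[OF Pr.sets_Q refl] Pr.nn_integral_exp_inner[OF s]
      by (subst nn_integral_cmult) auto
    finally show ?thesis .
  qed
  have "ennreal (laplace_transform (P (t + r)) s) = (\<integral>\<^sup>+u. ennreal (exp (s \<bullet> u)) \<partial>P (t + r))"
    using Ptr.nn_integral_exp_inner[OF s] by simp
  also have "\<dots> = (\<integral>\<^sup>+x. \<integral>\<^sup>+v. ennreal (exp (s \<bullet> v)) \<partial>K t (t + r) x \<partial>P t)"
    unfolding CK by (rule nn_integral_bind[OF meas kern])
  also have "\<dots> = (\<integral>\<^sup>+x. ennreal (exp (s \<bullet> x)) * ennreal (laplace_transform (P r) s) \<partial>P t)"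
    by (intro nn_integral_cong inner) (simp add: Pt.space_Q)
  also have "\<dots> = ennreal (laplace_transform (P t) s) * ennreal (laplace_transform (P r) s)"
    using meas measurable_cong_sets[OF Pt.sets_Q refl] Pt.nn_integral_exp_inner[OF s]
    by (subst nn_integral_multc) auto
  also have "\<dots> = ennreal (laplace_transform (P t) s * laplace_transform (P r) s)"
    using Pt.laplace_transform_pos[OF s] Pr.laplace_transform_pos[OF s] by (simp add: ennreal_mult)
  finally show ?thesis
    using Pt.laplace_transform_pos[OF s] Pr.laplace_transform_pos[OF s]
      Ptr.laplace_transform_pos[OF s] by simp
qed

text \<open>Multiplicativity along \<open>1/m, 2/m, \<dots>, 1\<close> exhibits the transform at time \<open>1/m\<close> as the
  positive \<open>m\<close>-th root of \<open>exp \<psi>\<close>. Here \<open>m = Suc n\<close>, which avoids the division by zero.\<close>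

lemma laplace_transform_root:
  assumes "homogeneous_markov_process M \<xi> K" "increment_laws K P"
    and s: "s \<in> neg_orthant" and \<psi>: "is_laplace_exponent P \<psi>"
  shows "laplace_transform (P (1 / Suc n)) s = exp (1 / Suc n * \<psi> s)"
proof -
  let ?y = "laplace_transform (P (1 / Suc n)) s"
  have pow: "laplace_transform (P (real (Suc k) * (1 / Suc n))) s = ?y ^ Suc k" for k
  proof (induction k)
    case (Suc k)
    have "real (Suc (Suc k)) * (1 / Suc n) = real (Suc k) * (1 / Suc n) + 1 / Suc n"
      by (simp add: add_divide_distrib)
    then show ?case
      using laplace_transform_semigroup[OF assms(1,2) _ _ s,
          of "real (Suc k) * (1 / Suc n)" "1 / Suc n"] Suc by simp
  qed simp
  have "0 < ?y"
    using orthant_prob.laplace_transform_pos[OF increment_laws_orthant_prob[OF assms(2)] s] by simp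
  moreover have "exp (\<psi> s) = ?y ^ Suc n"
    using pow[of n] \<psi> s by (simp add: is_laplace_exponent_def)
  ultimately have "\<psi> s = Suc n * ln ?y"
    by (metis ln_exp ln_realpow)
  then show ?thesis using \<open>0 < ?y\<close> by simp
qed

theorem mainTheorem6:
  fixes M :: "'a measure"
    and \<xi> :: "real \<Rightarrow> 'a \<Rightarrow> real ^ 'n"
    and K :: "real \<Rightarrow> real \<Rightarrow> real ^ 'n \<Rightarrow> (real ^ 'n) measure"
    and P :: "real \<Rightarrow> (real ^ 'n) measure"
  assumes "homogeneous_markov_process M \<xi> K"
    and "increment_laws K P"
  shows "(\<exists>\<psi>. is_laplace_exponent P \<psi>) \<and>
    (\<forall>\<psi>. is_laplace_exponent P \<psi> \<longrightarrow> \<psi> \<in> T_class)"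
proof (intro conjI allI impI)
  let ?U = "neg_orthant :: (real ^ 'n) set"
  note U = open_neg_orthant
  interpret P1: orthant_prob "P 1" using increment_laws_orthant_prob[OF assms(2)] by simp
  show "\<exists>\<psi>. is_laplace_exponent P \<psi>"
    using P1.laplace_transform_pos
    by (intro exI[of _ "\<lambda>s. ln (laplace_transform (P 1) s)"]) (simp add: is_laplace_exponent_def)
  fix \<psi> assume \<psi>: "is_laplace_exponent P \<psi>"
  then have \<psi>_eq: "ln (laplace_transform (P 1) s) = \<psi> s" if "s \<in> ?U" for s
    using that by (simp add: is_laplace_exponent_def)
  have smooth: "C_infinity_on ?U \<psi>"
    using P1.absolutely_monotone_laplace P1.laplace_transform_pos
    by (intro C_infinity_cong[OF U \<psi>_eq] C_infinity_ln[OF U]) (auto simp: absolutely_monotone_def)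
  have nonpos: "\<psi> s \<le> 0" if "s \<in> ?U" for s
    using \<psi>_eq[OF that] P1.laplace_transform_pos[OF that] P1.laplace_transform_le_1[OF that]
    by (metis ln_le_zero_iff)
  define g where "g n = laplace_transform (P (1 / Suc n))" for n
  have g_am: "absolutely_monotone (g n)" for n
    unfolding g_def
    by (intro orthant_prob.absolutely_monotone_laplace increment_laws_orthant_prob[OF assms(2)]) simp
  then have g_smooth: "C_infinity_on ?U (g n)" for n by (simp add: absolutely_monotone_def)
  have g_exp: "g n s = exp (1 / Suc n * \<psi> s)" if "s \<in> ?U" for n s
    unfolding g_def by (rule laplace_transform_root[OF assms that \<psi>])
  have dg: "partial_on ?U i (g n) (\<lambda>x. 1 / Suc n * (partial_deriv i \<psi> x * g n x))" for n i
  proof -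
    have "partial_on ?U i (\<lambda>x. exp (1 / Suc n * \<psi> x))
        (\<lambda>x. (exp (1 / Suc n * \<psi> x) * (1 / Suc n)) * partial_deriv i \<psi> x)"
      by (rule partial_on_compose[OF C_infinity_partial_on[OF smooth]])
         (auto intro!: derivative_eq_intros)
    then show ?thesis by (rule partial_on_cong[OF U]) (use g_exp in auto)
  qed
  have null: "(\<lambda>n. 1 / real (Suc n)) \<longlonglongrightarrow> 0"
    using LIMSEQ_inverse_real_of_nat by (simp add: inverse_eq_divide)
  have g1: "(\<lambda>n. g n x) \<longlonglongrightarrow> 1" if "x \<in> ?U" for x
  proof -
    have "(\<lambda>n. exp (1 / real (Suc n) * \<psi> x)) \<longlonglongrightarrow> exp (0 * \<psi> x)"
      by (intro tendsto_intros null)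
    then show ?thesis using g_exp[OF that] by simp
  qed
  have deriv_nonneg: "0 \<le> iter_partial is (partial_deriv i \<psi>) x" if x: "x \<in> ?U" for "is" i x
  proof (rule LIMSEQ_le_const)
    show "(\<lambda>n. iter_partial is (\<lambda>x. partial_deriv i \<psi> x * g n x) x) \<longlonglongrightarrow>
        iter_partial is (partial_deriv i \<psi>) x"
      by (rule iter_partial_mult_tendsto[OF U smooth g_smooth dg null g1 x
            C_infinity_partial_deriv[OF smooth]])
    have "0 \<le> iter_partial is (\<lambda>x. partial_deriv i \<psi> x * g n x) x" for n
    proof -
      \<comment> \<open>\<open>\<partial>\<^sub>i\<psi> g\<^sub>n = Suc n * \<partial>\<^sub>i g\<^sub>n\<close>, with the factor \<open>Suc n\<close> split as \<open>1 + n\<close> to fit the linearity lemma.\<close>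
      let ?d = "partial_deriv i (g n)"
      have "iter_partial is (\<lambda>x. partial_deriv i \<psi> x * g n x) x =
          iter_partial is (\<lambda>x. ?d x + real n * ?d x) x"
        by (rule iter_partial_cong[OF U _ x])
           (simp add: partial_on_imp_eq[OF dg] divide_simps, simp add: algebra_simps)
      also have "\<dots> = iter_partial is ?d x + real n * iter_partial is ?d x"
        by (intro iter_partial_add_cmult[OF U _ _ x] C_infinity_partial_deriv g_smooth)
      also have "0 \<le> \<dots>"
      proof -
        have "0 \<le> iter_partial (is @ [i]) (g n) x"
          using g_am x unfolding absolutely_monotone_def by blast
        then show ?thesis by (simp add: iter_partial_append)
      qed
      finally show ?thesis .
    qed
    then show "\<exists>N. \<forall>n\<ge>N. 0 \<le> iter_partial is (\<lambda>x. partial_deriv i \<psi> x * g n x) x" by blast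
  qed
  show "\<psi> \<in> T_class"
    unfolding T_class_def absolutely_monotone_def
    using smooth nonpos deriv_nonneg C_infinity_partial_deriv[OF smooth] by auto
qed

end
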